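(* Suppose that $X$ is a strictly convex Banach space that is not uniformly convex. Then there exists a finite metric space $Y$ such that for each $\epsilon > 0$ there is an embedding of $Y$ into $X$ with distortion $1+\epsilon$, but there is no isometric embedding of $Y$ into $X$.
   Context: Let $S_X$ denote the unit sphere of $X$. $X$ is strictly convex if $\|x+y\| < 2$ for any $x \neq y$ in $S_X$. $X$ is uniformly convex if for all $\epsilon \in (0,2]$ there is some $\delta > 0$ such that whenever $x,y \in S_X$ satisfy $\|x-y\| = \epsilon$, we have $\|x+y\| \leq 2-2\delta$. A map $f: Y \to X$ from a metric space $(Y,d_Y)$ to $X$ has distortion $K$ if there is some $r>0$ such that $r\, d_Y(x,y) \leq \|f(x)-f(y)\| \leq rK\, d_Y(x,y)$ for all $x,y \in Y$. Isometric embeddings are distance-preserving maps, not assumed linear. *)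

theory Defs
  imports "HOL-Analysis.Analysis"
begin

definition strictly_convex_space :: "'a::real_normed_vector itself \<Rightarrow> bool" where
  "strictly_convex_space _ \<longleftrightarrow>
     (\<forall>x\<in>sphere (0::'a) 1. \<forall>y\<in>sphere 0 1. x \<noteq> y \<longrightarrow> norm (x + y) < 2)"

definition uniformly_convex_space :: "'a::real_normed_vector itself \<Rightarrow> bool" where
  "uniformly_convex_space _ \<longleftrightarrow>
     (\<forall>\<epsilon>\<in>{0<..2::real}. \<exists>\<delta>>0. \<forall>x\<in>sphere (0::'a) 1. \<forall>y\<in>sphere 0 1.
        norm (x - y) = \<epsilon> \<longrightarrow> norm (x + y) \<le> 2 - 2 * \<delta>)"

definition has_distortion ::
  "'b metric \<Rightarrow> ('b \<Rightarrow> 'a::real_normed_vector) \<Rightarrow> real \<Rightarrow> bool" where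
  "has_distortion Y f K \<longleftrightarrow>
     (\<exists>r>0. \<forall>x\<in>mspace Y. \<forall>y\<in>mspace Y.
        r * mdist Y x y \<le> norm (f x - f y) \<and> norm (f x - f y) \<le> r * K * mdist Y x y)"

definition isometric_embedding ::
  "'b metric \<Rightarrow> ('b \<Rightarrow> 'a::real_normed_vector) \<Rightarrow> bool" where
  "isometric_embedding Y f \<longleftrightarrow>
     (\<forall>x\<in>mspace Y. \<forall>y\<in>mspace Y. norm (f x - f y) = mdist Y x y)"

end

(* In a strictly convex space midpoints are unique, so the four-point space p, x, y, q, in which x and y
   are distinct metric midpoints of p and q, does not embed isometrically. If uniform convexity
   fails at e = d(x, y), there are unit vectors x, y at distance e with |x + y| arbitrarily close
   to 2, and the vertices 0, x, y, x + y of a parallelogram realise every distance exactly, except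
   that |x + y| replaces d(p, q) = 2. *)

theory Submission
  imports Defs
begin

text \<open>The points 0, 1, 2, 3 stand for p, x, y, q; the condition \<open>i + j = 3\<close> singles out the pairs
  of opposite points \<open>{p, q}\<close> and \<open>{x, y}\<close>.\<close>

definition two_midpoint_dist :: "real \<Rightarrow> nat \<Rightarrow> nat \<Rightarrow> real" where
  "two_midpoint_dist e i j =
     (if i = j then 0 else if i + j = 3 then (if i = 0 \<or> j = 0 then 2 else e) else 1)"

text \<open>Each point has at most one opposite, so among three distinct points at most one side
  differs from 1. If it is the side to be bounded, it is at most 2 = 1 + 1; otherwise that side is 1
  and so is one of the other two.\<close>

lemma Metric_space_two_midpoint_dist:
  assumes "0 < e" "e \<le> 2"
  shows "Metric_space M (two_midpoint_dist e)"
proof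
  fix x y z
  show "0 \<le> two_midpoint_dist e x y"
    using assms by (simp add: two_midpoint_dist_def)
  show "two_midpoint_dist e x y = two_midpoint_dist e y x"
    by (auto simp: two_midpoint_dist_def)
  show "two_midpoint_dist e x y = 0 \<longleftrightarrow> x = y"
    using assms by (simp add: two_midpoint_dist_def)
  show "two_midpoint_dist e x z \<le> two_midpoint_dist e x y + two_midpoint_dist e y z"
  proof (cases "x = y \<or> y = z \<or> x = z")
    case True
    then show ?thesis
      using assms by (elim disjE) (simp_all add: two_midpoint_dist_def)
  next
    case distinct: False
    show ?thesis
    proof (cases "x + z = 3")
      case True
      then have "x + y \<noteq> 3" "y + z \<noteq> 3"
        using distinct by linarith+
      then show ?thesis
        using distinct assms by (simp add: two_midpoint_dist_def)
    next
      case False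
      have "x + y \<noteq> 3 \<or> y + z \<noteq> 3"
        using distinct by linarith
      then show ?thesis
        using False distinct assms by (elim disjE) (simp_all add: two_midpoint_dist_def)
    qed
  qed
qed

lemma strictly_convex_space_unit_eq:
  fixes u v :: "'a::real_normed_vector"
  assumes "strictly_convex_space TYPE('a)" "norm u = 1" "norm v = 1" "norm (u + v) = 2"
  shows "u = v"
  using assms unfolding strictly_convex_space_def by (metis less_irrefl mem_sphere_0)

text \<open>The unit vectors \<open>a - m\<close> and \<open>m - b\<close> add up to
  \<open>a - b\<close>, of norm 2, so strict convexity makes them equal.\<close>

lemma strictly_convex_space_midpoint:
  fixes a b m :: "'a::real_normed_vector"
  assumes "strictly_convex_space TYPE('a)"
    and "norm (a - m) = 1" "norm (m - b) = 1" "norm (a - b) = 2"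
  shows "m = midpoint a b"
proof -
  have "a - m = m - b"
    using assms by (auto intro!: strictly_convex_space_unit_eq[OF assms(1)])
  then have "a + b = 2 *\<^sub>R m"
    by (simp add: algebra_simps scaleR_2)
  then show ?thesis
    by (simp add: midpoint_def)
qed

theorem proposition4p8:
  assumes "strictly_convex_space TYPE('a::banach)"
    and "\<not> uniformly_convex_space TYPE('a)"
  shows "\<exists>Y :: nat metric. finite (mspace Y) \<and>
           (\<forall>\<epsilon>>0. \<exists>f :: nat \<Rightarrow> 'a. has_distortion Y f (1 + \<epsilon>)) \<and>
           (\<nexists>f :: nat \<Rightarrow> 'a. isometric_embedding Y f)"
proof -
  obtain e where e: "0 < e" "e \<le> 2"
    and close: "\<And>\<delta>. \<delta> > 0 \<Longrightarrow> \<exists>x y :: 'a. norm x = 1 \<and> norm y = 1 \<and>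
                  norm (x - y) = e \<and> norm (x + y) > 2 - 2 * \<delta>"
    using assms(2) unfolding uniformly_convex_space_def by (force simp: not_le)
  define Y where "Y = metric ({0, 1, 2, 3}, two_midpoint_dist e)"
  interpret Metric_space "{0, 1, 2, 3}" "two_midpoint_dist e"
    using e by (rule Metric_space_two_midpoint_dist)
  have mspace_Y: "mspace Y = {0, 1, 2, 3}" and mdist_Y: "mdist Y = two_midpoint_dist e"
    unfolding Y_def by (rule mspace_metric, rule mdist_metric)
  have "\<exists>f :: nat \<Rightarrow> 'a. has_distortion Y f (1 + \<epsilon>)" if "\<epsilon> > 0" for \<epsilon>
  proof -
    \<comment> \<open>With this value as \<delta>, the bound 2 - 2 \<delta> equals 2 / (1 +
      \<epsilon>).\<close>
    have "0 < \<epsilon> / (1 + \<epsilon>)"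
      using that by simp
    then obtain x y :: 'a where xy: "norm x = 1" "norm y = 1" "norm (x - y) = e"
      and gt: "norm (x + y) > 2 - 2 * (\<epsilon> / (1 + \<epsilon>))"
      using close by blast
    \<comment> \<open>This scale makes the lower distortion bound an equality for the pair 0, 3. The
      pairs whose distance is preserved then need only r \<le> 1 \<le> r (1 + \<epsilon>).\<close>
    define r where "r = norm (x + y) / 2"
    define f where
      "f = (\<lambda>i::nat. if i = 0 then 0 else if i = 1 then x else if i = 2 then y else x + y)"
    have r: "r > 0" "r \<le> 1" "1 \<le> r * (1 + \<epsilon>)"
    proof -
      have "1 / (1 + \<epsilon>) < r"
        using gt that by (simp add: r_def field_simps)
      moreover have "0 < 1 / (1 + \<epsilon>)"
        using that by simp
      ultimately show "r > 0" "1 \<le> r * (1 + \<epsilon>)"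
        using that by (linarith, simp add: field_simps)
      show "r \<le> 1"
        using norm_triangle_ineq[of x y] xy by (simp add: r_def)
    qed
    have "norm (x + y) = 2 * r"
      by (simp add: r_def)
    \<comment> \<open>The first two bounds serve the pair 1, 2; the third, doubled, is the upper
      bound for the pair 0, 3.\<close>
    moreover have "r * e \<le> e" "e \<le> r * (1 + \<epsilon>) * e" "r \<le> r * (1 + \<epsilon>)"
      using r e that by (simp_all add: mult_le_cancel_right1 mult_le_cancel_left1)
    ultimately have "has_distortion Y f (1 + \<epsilon>)"
      unfolding has_distortion_def mspace_Y mdist_Y using r xy
      by (intro exI[of _ r])
         (auto simp: f_def two_midpoint_dist_def norm_minus_commute
               simp flip: minus_add_distrib)
    then show ?thesis
      by blast
  qed
  moreover have False if f: "isometric_embedding Y f" for f :: "nat \<Rightarrow> 'a"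
  proof -
    have dist_f: "norm (f i - f j) = two_midpoint_dist e i j" if "i \<in> {0, 1, 2, 3}" "j \<in> {0, 1, 2, 3}" for i j
      using f that unfolding isometric_embedding_def mspace_Y mdist_Y by blast
    \<comment> \<open>Points 1 and 2 are both at distance 1 from 0 and from 3, so their images
      coincide, against \<open>0 < e\<close>.\<close>
    have "f i = midpoint (f 0) (f 3)" if "i \<in> {1, 2}" for i
      using that
      by (intro strictly_convex_space_midpoint[OF assms(1)])
         (auto simp: dist_f two_midpoint_dist_def)
    then have "f 1 = f 2"
      by simp
    then show False
      using dist_f[of 1 2] e by (simp add: two_midpoint_dist_def)
  qed
  ultimately show ?thesis
    by (intro exI[of _ Y]) (auto simp: mspace_Y)
qed

end
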